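(* Let $w\in\mathfrak{S}_n$. The following are equivalent: (i) $w$ avoids the patterns $4231$, $35142$, $42513$ and $351624$; (ii) $\ell'(uw^{-1})=a\ell(u,w)$ for all $u<w$ in the Bruhat order.
   Context: $\mathfrak{S}_n$ is the Coxeter group with generators the adjacent transpositions; $T$ is the set of all transpositions; $\ell$ is Coxeter length; permutations act on the right on $[n]$ and $uw$ means "first $u$, then $w$". The absolute length $\ell'(v)$ is the smallest number of transpositions whose product is $v$. The Bruhat graph is the directed graph on $\mathfrak{S}_n$ with an edge $x\to tx$ whenever $t\in T$ and $\ell(x)<\ell(tx)$; for $u\le w$, $a\ell(u,w)$ is the length of a shortest directed path from $u$ to $w$ in it. Pattern avoidance: for $p\in\mathfrak{S}_m$ in one-line notation, $w$ avoids $p$ if there are no $i_1<\cdots<i_m$ with $i_aw<i_bw\iff ap<bp$ for all $a,b$. *)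

theory Defs
  imports "HOL-Combinatorics.Permutations"
begin

text \<open>
  Elements of the symmetric group on \<open>[n]\<close> are functions \<open>w\<close> with \<open>w permutes {1..n}\<close>.
  Permutations act on the right: \<open>i w\<close> is rendered as \<open>w i\<close>, and the product \<open>u \<cdot> w\<close> is
  ``first \<open>u\<close>, then \<open>w\<close>'', the opposite of function composition.
\<close>

definition pmult :: "(nat \<Rightarrow> nat) \<Rightarrow> (nat \<Rightarrow> nat) \<Rightarrow> nat \<Rightarrow> nat"  (infixl "\<cdot>" 70)
  where "u \<cdot> w = w \<circ> u"

definition word_prod :: "(nat \<Rightarrow> nat) list \<Rightarrow> nat \<Rightarrow> nat"
  where "word_prod ts = foldr (\<cdot>) ts id"

definition adjacent_transpositions :: "nat \<Rightarrow> (nat \<Rightarrow> nat) set"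
  where "adjacent_transpositions n = {transpose i (i + 1) | i. 1 \<le> i \<and> i < n}"

definition transpositions :: "nat \<Rightarrow> (nat \<Rightarrow> nat) set"
  where "transpositions n = {transpose i j | i j. 1 \<le> i \<and> i < j \<and> j \<le> n}"

text \<open>Meaningful only for \<open>v\<close> in the group generated by the involutions in \<open>S\<close>.\<close>

definition word_length :: "(nat \<Rightarrow> nat) set \<Rightarrow> (nat \<Rightarrow> nat) \<Rightarrow> nat"
  where "word_length S v = (LEAST k. \<exists>ts. set ts \<subseteq> S \<and> length ts = k \<and> word_prod ts = v)"

definition coxeter_length :: "nat \<Rightarrow> (nat \<Rightarrow> nat) \<Rightarrow> nat"
  where "coxeter_length n = word_length (adjacent_transpositions n)"

definition absolute_length :: "nat \<Rightarrow> (nat \<Rightarrow> nat) \<Rightarrow> nat"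
  where "absolute_length n = word_length (transpositions n)"

definition bruhat_graph :: "nat \<Rightarrow> ((nat \<Rightarrow> nat) \<times> (nat \<Rightarrow> nat)) set"
  where "bruhat_graph n = {(x, t \<cdot> x) | x t. x permutes {1..n} \<and> t \<in> transpositions n \<and>
           coxeter_length n x < coxeter_length n (t \<cdot> x)}"

definition bruhat_le :: "nat \<Rightarrow> (nat \<Rightarrow> nat) \<Rightarrow> (nat \<Rightarrow> nat) \<Rightarrow> bool"
  where "bruhat_le n u w \<longleftrightarrow>
           u permutes {1..n} \<and> w permutes {1..n} \<and> (u, w) \<in> (bruhat_graph n)\<^sup>*"

definition bruhat_less :: "nat \<Rightarrow> (nat \<Rightarrow> nat) \<Rightarrow> (nat \<Rightarrow> nat) \<Rightarrow> bool"
  where "bruhat_less n u w \<longleftrightarrow> bruhat_le n u w \<and> u \<noteq> w"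

text \<open>Meaningful only for \<open>bruhat_le n u w\<close>, when a directed path exists.\<close>

definition bruhat_dist :: "nat \<Rightarrow> (nat \<Rightarrow> nat) \<Rightarrow> (nat \<Rightarrow> nat) \<Rightarrow> nat"
  where "bruhat_dist n u w = (LEAST k. (u, w) \<in> bruhat_graph n ^^ k)"

text \<open>The list \<open>[1 p, \<dots>, m p]\<close> determines \<open>p\<close>; list positions are shifted by one.\<close>

definition one_line :: "nat list \<Rightarrow> nat \<Rightarrow> nat"
  where "one_line xs i = (if i \<in> {1..length xs} then xs ! (i - 1) else i)"

definition avoids :: "nat \<Rightarrow> (nat \<Rightarrow> nat) \<Rightarrow> nat \<Rightarrow> (nat \<Rightarrow> nat) \<Rightarrow> bool"
  where "avoids n w m p \<longleftrightarrow>
           \<not> (\<exists>pos. strict_mono_on {1..m} pos \<and> pos ` {1..m} \<subseteq> {1..n} \<and>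
                (\<forall>a\<in>{1..m}. \<forall>b\<in>{1..m}. w (pos a) < w (pos b) \<longleftrightarrow> p a < p b))"

end

theory Submission
  imports Defs "HOL-Combinatorics.Orbits"
begin

text \<open>
  An edge of the Bruhat graph exchanges the values at two positions that form an ascent, and
  \<open>\<ell>'(u w\<^sup>-\<^sup>1)\<close> is \<open>n\<close> minus the number of cycles of \<open>w\<^sup>-\<^sup>1 \<circ> u\<close> acting on positions. So condition (ii)
  asks for a path from \<open>u\<close> to \<open>w\<close> each of whose steps splits a cycle.

  If \<open>w\<close> avoids the patterns, such a path is built greedily inside the right hull of \<open>w\<close>, the skew
  board of all cells having a point of \<open>w\<close> weakly to the upper left and one weakly to the lower
  right. It contains the diagram of every \<open>u \<le> w\<close>. Let \<open>a\<close> be the first position where \<open>u\<close> and \<open>w\<close>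
  differ. Avoiding 4231 and 42513 forces \<open>u a < w a\<close>; following the cycle of \<open>a\<close>, avoiding 35142 and
  351624 yields a position \<open>p\<close> in this cycle with which \<open>a\<close> can be exchanged upwards without leaving
  the hull. In particular the hull never has to be compared with the Bruhat order.

  Conversely, rearranging an occurrence of 4231, 35142, 42513 or 351624 to 1324, 12435, 13245 or
  124356 gives a \<open>u < w\<close> such that on some union of cycles \<open>u\<close> is not below \<open>w\<close>, whereas a path
  splitting a cycle at each step would ascend on every cycle.
\<close>

section \<open>Coxeter length and inversions\<close>

definition inversions :: "nat \<Rightarrow> (nat \<Rightarrow> nat) \<Rightarrow> (nat \<times> nat) set"
  where "inversions n x = {(p, q). 1 \<le> p \<and> p < q \<and> q \<le> n \<and> x q < x p}"

lemma finite_inversions [simp]: "finite (inversions n x)"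
  by (rule finite_subset[of _ "{1..n} \<times> {1..n}"]) (auto simp: inversions_def)

lemma word_prod_simps:
  "word_prod [] = id" "word_prod (t # ts) = word_prod ts \<circ> t"
  by (simp_all add: word_prod_def pmult_def)

lemma permutes_comp_transpose:
  assumes "x permutes S" "i \<in> S" "j \<in> S"
  shows "x \<circ> transpose i j permutes S"
  using assms by (intro permutes_compose permutes_swap_id)

text \<open>The inversions of \<open>x\<close> are mapped injectively to inversions of
  \<open>x \<circ> transpose i j\<close>, and \<open>(i, j)\<close>, an inversion only after the
  exchange, is missed.\<close>

lemma card_inversions_less_transpose:
  assumes ij: "1 \<le> i" "i < j" "j \<le> n" and up: "x i < x j"
  shows "card (inversions n x) < card (inversions n (x \<circ> transpose i j))"
proof -
  let ?t = "transpose i j"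
  \<comment> \<open>\<open>f\<close> carries a pair along the exchange unless this reverses its
    order; then the pair is kept. On pairs \<open>p < q\<close> it is its own inverse.\<close>
  define f where "f = (\<lambda>(p, q). if ?t p < ?t q then (?t p, ?t q) else (p, q))"
  have inj: "inj_on f (inversions n x)"
    by (rule inj_on_inverseI[of _ f]) (auto simp: f_def inversions_def)
  have sub: "f ` inversions n x \<subseteq> inversions n (x \<circ> ?t) - {(i, j)}"
  proof (rule image_subsetI, clarify)
    fix p q
    assume "(p, q) \<in> inversions n x"
    then have pq: "1 \<le> p" "p < q" "q \<le> n" "x q < x p"
      by (auto simp: inversions_def)
    have range: "1 \<le> ?t k \<and> ?t k \<le> n" if "1 \<le> k" "k \<le> n" for k
      using that ij by (auto simp: transpose_def)
    show "f (p, q) \<in> inversions n (x \<circ> ?t) - {(i, j)}"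
    proof (cases "?t p < ?t q")
      case True
      moreover have "(?t p, ?t q) \<noteq> (i, j)"
        using pq(2) ij(2) by (metis Pair_inject less_asym transpose_apply_first
            transpose_apply_second transpose_involutory)
      ultimately show ?thesis
        using pq range by (simp add: f_def inversions_def)
    next
      case False
      \<comment> \<open>A pair whose order is reversed joins \<open>i\<close> or \<open>j\<close> to
        a position between them; \<open>(i, j)\<close> is excluded because
        \<open>x i < x j\<close>.\<close>
      then have "p = i \<and> i < q \<and> q < j \<or> q = j \<and> i < p \<and> p < j"
        using pq up ij by (cases "p = i"; cases "p = j"; cases "q = i"; cases "q = j") auto
      then show ?thesis
        using False pq up by (elim disjE conjE) (simp_all add: f_def inversions_def)
    qed
  qed
  have "card (inversions n x) = card (f ` inversions n x)"
    using inj by (simp add: card_image)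
  also have "\<dots> \<le> card (inversions n (x \<circ> ?t) - {(i, j)})"
    using sub by (intro card_mono) auto
  also have "\<dots> < card (inversions n (x \<circ> ?t))"
    using ij up by (intro card_Diff1_less finite_inversions) (simp add: inversions_def)
  finally show ?thesis .
qed

text \<open>An adjacent exchange reverses the order of no pair of positions except
  \<open>(k, k + 1)\<close>.\<close>

lemma card_inversions_adjacent_le:
  assumes "1 \<le> k" "k < n"
  shows "card (inversions n (x \<circ> transpose k (k + 1))) \<le> card (inversions n x) + 1"
proof -
  let ?t = "transpose k (k + 1)" and ?y = "x \<circ> transpose k (k + 1)"
  define f where "f = map_prod ?t ?t"
  have "inj f"
    unfolding f_def by (intro prod.inj_map) auto
  then have inj: "inj_on f (inversions n ?y - {(k, k + 1)})"
    by (rule inj_on_subset) simp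
  have sub: "f ` (inversions n ?y - {(k, k + 1)}) \<subseteq> inversions n x"
  proof (rule image_subsetI)
    fix r
    assume r: "r \<in> inversions n ?y - {(k, k + 1)}"
    obtain p q where pq_def: "r = (p, q)"
      by fastforce
    with r have pq: "1 \<le> p" "p < q" "q \<le> n" "x (?t q) < x (?t p)" "p = k \<longrightarrow> q \<noteq> k + 1"
      by (auto simp: inversions_def)
    moreover have "1 \<le> ?t p \<and> ?t p < ?t q \<and> ?t q \<le> n"
      using pq(1,2,3,5) assms unfolding transpose_def by presburger
    ultimately show "f r \<in> inversions n x"
      by (simp add: pq_def f_def inversions_def)
  qed
  have "card (inversions n ?y - {(k, k + 1)}) \<le> card (inversions n x)"
    using card_inj_on_le[OF inj sub] by simp
  moreover have "card (inversions n ?y) \<le> card (inversions n ?y - {(k, k + 1)}) + 1"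
    by (auto simp: card_Diff_singleton_if)
  ultimately show ?thesis
    by linarith
qed

lemma card_inversions_word_prod_le:
  assumes "set ts \<subseteq> adjacent_transpositions n"
  shows "card (inversions n (word_prod ts)) \<le> length ts"
  using assms
proof (induction ts)
  case Nil
  have "inversions n id = {}"
    by (auto simp: inversions_def)
  then show ?case
    by (simp only: word_prod_simps card.empty)
next
  case (Cons t ts)
  then obtain k where "t = transpose k (k + 1)" "1 \<le> k" "k < n"
    by (auto simp: adjacent_transpositions_def)
  with card_inversions_adjacent_le[of k n "word_prod ts"]
  have "card (inversions n (word_prod (t # ts))) \<le> card (inversions n (word_prod ts)) + 1"
    by (simp only: word_prod_simps)
  with Cons show ?case
    by simp
qed

lemma permutes_ascending_eq_id:
  fixes x :: "nat \<Rightarrow> nat"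
  assumes "x permutes {1..n}" and "\<And>k. 1 \<le> k \<Longrightarrow> k < n \<Longrightarrow> x k < x (k + 1)"
  shows "x = id"
proof -
  have "k \<le> x k" if "1 \<le> k" "k \<le> n" for k
    using that
  proof (induction k)
    case (Suc k)
    show ?case
    proof (cases "k = 0")
      case True
      then have "x (Suc k) \<in> {1..n}"
        using Suc.prems permutes_in_image[OF assms(1)] by auto
      with True show ?thesis
        by simp
    next
      case False
      then have "k \<le> x k" "x k < x (k + 1)"
        using Suc assms(2) by simp_all
      then show ?thesis
        by simp
    qed
  qed simp
  then show ?thesis
    using permutes_natset_ge[OF assms(1)] by auto
qed

text \<open>Bubble sort: exchanging an adjacent descent removes an inversion, and a permutation
  without adjacent descents is the identity.\<close>

lemma word_of_inversions:
  assumes "x permutes {1..n}"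
  shows "\<exists>ts. set ts \<subseteq> adjacent_transpositions n \<and> length ts \<le> card (inversions n x) \<and>
           word_prod ts = x"
  using assms
proof (induction "card (inversions n x)" arbitrary: x rule: less_induct)
  case less
  show ?case
  proof (cases "\<exists>k. 1 \<le> k \<and> k < n \<and> x (k + 1) < x k")
    case True
    then obtain k where k: "1 \<le> k" "k < n" "x (k + 1) < x k"
      by blast
    define t where "t = transpose k (k + 1)"
    have "card (inversions n (x \<circ> t)) < card (inversions n ((x \<circ> t) \<circ> t))"
      unfolding t_def using k by (intro card_inversions_less_transpose) auto
    then have lt: "card (inversions n (x \<circ> t)) < card (inversions n x)"
      by (simp add: t_def comp_assoc)
    have "x \<circ> t permutes {1..n}"
      unfolding t_def using k less.prems by (intro permutes_comp_transpose) auto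
    with less.hyps[OF lt] obtain ts where ts: "set ts \<subseteq> adjacent_transpositions n"
      "length ts \<le> card (inversions n (x \<circ> t))" "word_prod ts = x \<circ> t"
      by blast
    have "word_prod (t # ts) = x"
      using ts(3) by (simp add: word_prod_simps t_def comp_assoc)
    moreover have "t \<in> adjacent_transpositions n"
      unfolding t_def adjacent_transpositions_def using k by blast
    then have "set (t # ts) \<subseteq> adjacent_transpositions n"
      using ts(1) by simp
    moreover have "length (t # ts) \<le> card (inversions n x)"
      using ts(2) lt by simp
    ultimately show ?thesis
      by (intro exI[of _ "t # ts"] conjI)
  next
    case False
    have "x k < x (k + 1)" if "1 \<le> k" "k < n" for k
    proof -
      have "x k \<noteq> x (k + 1)"
        using injD[OF permutes_inj[OF less.prems], of k "k + 1"] by auto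
      with False that show ?thesis
        by (meson linorder_neqE_nat)
    qed
    then have "x = id"
      by (rule permutes_ascending_eq_id[OF less.prems])
    then show ?thesis
      by (intro exI[of _ "[]"]) (simp add: word_prod_simps)
  qed
qed

lemma coxeter_length_eq_card_inversions:
  assumes "x permutes {1..n}"
  shows "coxeter_length n x = card (inversions n x)"
  unfolding coxeter_length_def word_length_def
proof (rule Least_equality)
  show "\<exists>ts. set ts \<subseteq> adjacent_transpositions n \<and> length ts = card (inversions n x) \<and>
          word_prod ts = x"
    using word_of_inversions[OF assms] card_inversions_word_prod_le by (metis le_antisym)
qed (use card_inversions_word_prod_le in auto)

section \<open>Edges of the Bruhat graph as ascents\<close>

lemma bruhat_graph_iff:
  "(x, y) \<in> bruhat_graph n \<longleftrightarrow>
     x permutes {1..n} \<and> (\<exists>i j. 1 \<le> i \<and> i < j \<and> j \<le> n \<and> x i < x j \<and> y = x \<circ> transpose i j)"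
proof -
  have "coxeter_length n x < coxeter_length n (x \<circ> transpose i j) \<longleftrightarrow> x i < x j"
    if x: "x permutes {1..n}" and ij: "1 \<le> i" "i < j" "j \<le> n" for i j
  proof -
    let ?y = "x \<circ> transpose i j"
    have "?y permutes {1..n}"
      using x ij by (intro permutes_comp_transpose) auto
    then have len: "coxeter_length n ?y = card (inversions n ?y)"
      "coxeter_length n x = card (inversions n x)"
      using x by (simp_all add: coxeter_length_eq_card_inversions)
    have "x i \<noteq> x j"
      using ij injD[OF permutes_inj[OF x], of i j] by auto
    then consider "x i < x j" | "x j < x i"
      by linarith
    then show ?thesis
    proof cases
      case 1
      with card_inversions_less_transpose[OF ij] show ?thesis
        by (simp add: len)
    next
      \<comment> \<open>Here \<open>?y\<close> ascends from \<open>i\<close> to \<open>j\<close>,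
        and exchanging again restores \<open>x\<close>.\<close>
      case 2
      with card_inversions_less_transpose[OF ij, of ?y] show ?thesis
        by (simp add: len comp_assoc)
    qed
  qed
  then show ?thesis
    unfolding bruhat_graph_def transpositions_def pmult_def mem_Collect_eq prod.inject
    by (metis (no_types, opaque_lifting))
qed

lemma bruhat_graph_permutes:
  assumes "(x, y) \<in> bruhat_graph n"
  shows "x permutes {1..n}" "y permutes {1..n}"
  using assms by (auto simp: bruhat_graph_iff intro!: permutes_comp_transpose)

section \<open>Absolute length and cycles\<close>

text \<open>Fixed points count as cycles, so the identity has \<open>n\<close> of them.\<close>

definition cycle_count :: "nat \<Rightarrow> (nat \<Rightarrow> nat) \<Rightarrow> nat"
  where "cycle_count n v = card (orbit v ` {1..n})"

lemma cycle_count_le: "cycle_count n v \<le> n"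
  unfolding cycle_count_def using card_image_le[of "{1..n}" "orbit v"] by simp

lemma cycle_count_id: "cycle_count n id = n"
proof -
  have "orbit id x = {x}" for x :: nat
    by (simp add: orbit_eq_singleton_iff)
  then show ?thesis
    by (simp add: cycle_count_def card_image)
qed

lemma orbit_eq:
  assumes "permutation v" "y \<in> orbit v x"
  shows "orbit v y = orbit v x"
  using orbit_cyclic_eq3[OF cyclic_on_orbit'[OF assms(1)] assms(2)] .

lemma orbit_comp_transpose:
  assumes "permutation v" "a \<notin> orbit v x" "b \<notin> orbit v x"
  shows "orbit (v \<circ> transpose a b) x = orbit v x"
proof (rule orbit_cong)
  show "x \<in> orbit v x"
    using assms(1) by (rule permutation_self_in_orbit)
  show "(v \<circ> transpose a b) s = v s" if "s \<in> orbit v x" for s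
    using that assms(2,3) by (metis comp_apply transpose_apply_other)
qed

text \<open>The new orbit of \<open>a\<close> continues with \<open>v b\<close>, follows the old
  cycle until it meets \<open>a\<close>, and closes up there without passing
  \<open>b\<close>.\<close>

lemma orbit_split:
  assumes v: "permutation v" and ab: "a \<noteq> b" "b \<in> orbit v a"
  shows "b \<notin> orbit (v \<circ> transpose a b) a"
proof -
  let ?v' = "v \<circ> transpose a b"
  have "a \<in> orbit v b"
    using orbit_eq[OF v ab(2)] permutation_self_in_orbit[OF v] by simp
  then obtain i0 where "0 < i0" "(v ^^ i0) b = a"
    by (auto simp: orbit_altdef)
  then obtain i where i: "0 < i" "(v ^^ i) b = a"
    and least: "\<And>j. 0 < j \<Longrightarrow> j < i \<Longrightarrow> (v ^^ j) b \<noteq> a"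
    using exists_least_iff[of "\<lambda>i. 0 < i \<and> (v ^^ i) b = a"] by metis
  define S where "S = {(v ^^ j) b | j. 0 < j \<and> j \<le> i}"
  \<comment> \<open>A return to \<open>b\<close> within the arc would let \<open>a\<close> be
    reached in fewer than \<open>i\<close> steps.\<close>
  have "(v ^^ j) b \<noteq> b" if "0 < j" "j \<le> i" for j
  proof
    assume "(v ^^ j) b = b"
    then have "(v ^^ (i - j)) b = a"
      using i that by (metis comp_apply funpow_add le_add_diff_inverse2)
    moreover have "j \<noteq> i"
      using \<open>(v ^^ j) b = b\<close> i(2) ab(1) by metis
    ultimately show False
      using least[of "i - j"] that by simp
  qed
  then have b: "b \<notin> S"
    unfolding S_def mem_Collect_eq by metis
  have "v b \<in> S"
    unfolding S_def using i by (auto intro: exI[of _ 1])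
  have closed: "?v' s \<in> S" if "s \<in> S" for s
  proof (cases "s = a")
    case True
    then show ?thesis
      using \<open>v b \<in> S\<close> by simp
  next
    case False
    obtain j where j: "0 < j" "j \<le> i" "s = (v ^^ j) b"
      using \<open>s \<in> S\<close> unfolding S_def by blast
    with False i have "j < i"
      by (cases "j = i") auto
    moreover have "?v' s = (v ^^ Suc j) b"
      using False b that j(3) by (metis comp_apply funpow.simps(2) transpose_apply_other)
    ultimately show ?thesis
      unfolding S_def by (metis (mono_tags, lifting) Suc_leI mem_Collect_eq zero_less_Suc)
  qed
  have "s \<in> S" if "s \<in> orbit ?v' a" for s
    using that
  proof induction
    case base
    then show ?case
      using \<open>v b \<in> S\<close> by simp
  qed (rule closed)
  with b show ?thesis
    by blast
qed

text \<open>This isolates the part of the count that a transposition of \<open>a\<close> and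
  \<open>b\<close> can change.\<close>

lemma cycle_count_eq:
  assumes v: "v permutes {1..n}" and ab: "a \<in> {1..n}" "b \<in> {1..n}"
  shows "cycle_count n v = card {X \<in> orbit v ` {1..n}. a \<notin> X \<and> b \<notin> X} +
           card {orbit v a, orbit v b}"
proof -
  have p: "permutation v"
    using v by (auto simp: permutation_permutes)
  let ?R = "{X \<in> orbit v ` {1..n}. a \<notin> X \<and> b \<notin> X}"
  have "orbit v ` {1..n} = ?R \<union> {orbit v a, orbit v b}"
    using ab orbit_eq[OF p, of a] orbit_eq[OF p, of b] by blast
  moreover have "?R \<inter> {orbit v a, orbit v b} = {}"
    using permutation_self_in_orbit[OF p, of a] permutation_self_in_orbit[OF p, of b] by blast
  ultimately show ?thesis
    unfolding cycle_count_def
    using card_Un_disjoint[of ?R "{orbit v a, orbit v b}"] by (metis (lifting) finite.emptyI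
        finite.insertI finite_Un finite_atLeastAtMost finite_imageI)
qed

lemma orbits_avoiding_comp_transpose:
  assumes "permutation v" "permutation (v \<circ> transpose a b)"
  shows "{X \<in> orbit (v \<circ> transpose a b) ` S. a \<notin> X \<and> b \<notin> X} =
           {X \<in> orbit v ` S. a \<notin> X \<and> b \<notin> X}"
proof -
  have *: "{X \<in> orbit v ` S. a \<notin> X \<and> b \<notin> X} \<subseteq> {X \<in> orbit (v \<circ> transpose a b) ` S. a \<notin> X \<and> b \<notin> X}"
    if "permutation v" for v
  proof clarify
    fix x assume "x \<in> S" "a \<notin> orbit v x" "b \<notin> orbit v x"
    with orbit_comp_transpose[OF that, of a x b]
    show "orbit v x \<in> orbit (v \<circ> transpose a b) ` S \<and> a \<notin> orbit v x \<and> b \<notin> orbit v x"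
      by (metis imageI)
  qed
  have "(v \<circ> transpose a b) \<circ> transpose a b = v"
    by (simp add: comp_assoc)
  with *[OF assms(1)] *[OF assms(2)] show ?thesis
    by auto
qed

text \<open>The cycles avoiding \<open>a\<close> and \<open>b\<close> are the same before and after.
  Each claim thus compares the number of cycles through \<open>a\<close> or \<open>b\<close>, which
  is 1 or 2.\<close>

lemma
  assumes v: "v permutes {1..n}" and ab: "a \<in> {1..n}" "b \<in> {1..n}"
  shows cycle_count_comp_transpose_le: "cycle_count n v \<le> cycle_count n (v \<circ> transpose a b) + 1"
    and cycle_count_comp_transpose_split:
      "a \<noteq> b \<Longrightarrow> b \<in> orbit v a \<Longrightarrow> cycle_count n (v \<circ> transpose a b) = cycle_count n v + 1"
    and cycle_count_comp_transpose_merge: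
      "b \<notin> orbit v a \<Longrightarrow> cycle_count n (v \<circ> transpose a b) \<le> cycle_count n v"
proof -
  let ?v' = "v \<circ> transpose a b"
  have v': "?v' permutes {1..n}"
    using v ab by (rule permutes_comp_transpose)
  have p: "permutation v" "permutation ?v'"
    using v v' by (auto simp: permutation_permutes)
  note eq = cycle_count_eq[OF v ab]
    cycle_count_eq[OF v' ab, unfolded orbits_avoiding_comp_transpose[OF p]]
  have bounds: "1 \<le> card {X, Y}" "card {X, Y} \<le> 2" for X Y :: "nat set"
    by (auto simp: card_insert_if)
  show "cycle_count n v \<le> cycle_count n ?v' + 1"
    using eq bounds(1)[of "orbit ?v' a" "orbit ?v' b"] bounds(2)[of "orbit v a" "orbit v b"]
    by linarith
  show "cycle_count n ?v' = cycle_count n v + 1" if "a \<noteq> b" "b \<in> orbit v a"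
  proof -
    have "orbit v b = orbit v a"
      using orbit_eq[OF p(1) that(2)] .
    moreover have "orbit ?v' a \<noteq> orbit ?v' b"
      using orbit_split[OF p(1) that] permutation_self_in_orbit[OF p(2), of b] by auto
    ultimately have "card {orbit v a, orbit v b} = 1" "card {orbit ?v' a, orbit ?v' b} = 2"
      by simp_all
    then show ?thesis
      using eq by linarith
  qed
  show "cycle_count n ?v' \<le> cycle_count n v" if "b \<notin> orbit v a"
  proof -
    have "orbit v a \<noteq> orbit v b"
      using that permutation_self_in_orbit[OF p(1), of b] by auto
    then have "card {orbit v a, orbit v b} = 2"
      by simp
    then show ?thesis
      using eq bounds(2)[of "orbit ?v' a" "orbit ?v' b"] by linarith
  qed
qed

section \<open>Words in transpositions and numbers of cycles\<close>

lemma word_prod_transpositions_permutes: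
  assumes "set ts \<subseteq> transpositions n"
  shows "word_prod ts permutes {1..n}"
  using assms
proof (induction ts)
  case (Cons t ts)
  then obtain i j where "t = transpose i j" "i \<in> {1..n}" "j \<in> {1..n}"
    by (auto simp: transpositions_def)
  with Cons have "word_prod ts \<circ> t permutes {1..n}"
    by (auto intro: permutes_comp_transpose)
  then show ?case
    by (simp only: word_prod_simps)
qed (simp only: word_prod_simps permutes_id)

lemma transpose_mem_transpositions:
  assumes "a \<in> {1..n}" "b \<in> {1..n}" "a \<noteq> b"
  shows "transpose a b \<in> transpositions n"
proof (cases "a < b")
  case True
  with assms show ?thesis
    by (auto simp: transpositions_def)
next
  case False
  with assms have "b < a"
    by simp
  with assms show ?thesis
    by (subst transpose_commute) (auto simp: transpositions_def)
qed

text \<open>The empty word has \<open>n\<close> cycles, and each letter lowers the count by at most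
  one.\<close>

lemma le_cycle_count_word_prod:
  assumes "set ts \<subseteq> transpositions n"
  shows "n \<le> cycle_count n (word_prod ts) + length ts"
  using assms
proof (induction ts)
  case Nil
  then show ?case
    by (simp only: word_prod_simps cycle_count_id)
next
  case (Cons t ts)
  then obtain i j where "t = transpose i j" "i \<in> {1..n}" "j \<in> {1..n}"
    by (auto simp: transpositions_def)
  with Cons cycle_count_comp_transpose_le[OF word_prod_transpositions_permutes, of ts n i j]
  have "cycle_count n (word_prod ts) \<le> cycle_count n (word_prod (t # ts)) + 1"
    by (simp only: word_prod_simps list.set insert_subset)
  with Cons show ?case
    by simp
qed

text \<open>If \<open>v\<close> moves \<open>a\<close>, then
  \<open>v \<circ> transpose a (v a)\<close> fixes \<open>v a\<close> and has one cycle more, at the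
  price of one letter.\<close>

lemma word_of_cycle_count:
  assumes "v permutes {1..n}"
  shows "\<exists>ts. set ts \<subseteq> transpositions n \<and> cycle_count n v + length ts \<le> n \<and> word_prod ts = v"
  using assms
proof (induction "n - cycle_count n v" arbitrary: v rule: less_induct)
  case less
  show ?case
  proof (cases "v = id")
    case True
    then show ?thesis
      by (intro exI[of _ "[]"]) (simp add: word_prod_simps cycle_count_le)
  next
    case False
    then obtain a where a: "v a \<noteq> a"
      unfolding fun_eq_iff id_apply by blast
    then have mem: "a \<in> {1..n}" "v a \<in> {1..n}"
      using less.prems permutes_not_in permutes_in_image by fastforce+
    define t where "t = transpose a (v a)"
    have split: "cycle_count n (v \<circ> t) = cycle_count n v + 1"
      unfolding t_def using a mem
      by (intro cycle_count_comp_transpose_split[OF less.prems]) (auto intro: orbit.base)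
    have perm: "v \<circ> t permutes {1..n}"
      unfolding t_def by (rule permutes_comp_transpose[OF less.prems mem])
    have "n - cycle_count n (v \<circ> t) < n - cycle_count n v"
      using split cycle_count_le[of n "v \<circ> t"] by simp
    from less.hyps[OF this perm] obtain ts where ts: "set ts \<subseteq> transpositions n"
      "cycle_count n (v \<circ> t) + length ts \<le> n" "word_prod ts = v \<circ> t"
      by blast
    have "word_prod (t # ts) = v"
      using ts(3) by (simp add: word_prod_simps t_def comp_assoc)
    moreover have "t \<in> transpositions n"
      unfolding t_def using mem a by (intro transpose_mem_transpositions) auto
    then have "set (t # ts) \<subseteq> transpositions n"
      using ts(1) by simp
    moreover have "cycle_count n v + length (t # ts) \<le> n"
      using ts(2) split by simp
    ultimately show ?thesis
      by (intro exI[of _ "t # ts"] conjI)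
  qed
qed

lemma absolute_length_eq:
  assumes "v permutes {1..n}"
  shows "absolute_length n v = n - cycle_count n v"
  unfolding absolute_length_def word_length_def
proof (rule Least_equality)
  obtain ts where ts: "set ts \<subseteq> transpositions n" "cycle_count n v + length ts \<le> n"
    "word_prod ts = v"
    using word_of_cycle_count[OF assms] by blast
  with le_cycle_count_word_prod[OF ts(1)]
  show "\<exists>ts. set ts \<subseteq> transpositions n \<and> length ts = n - cycle_count n v \<and> word_prod ts = v"
    by (intro exI[of _ ts]) auto
next
  fix k
  assume "\<exists>ts. set ts \<subseteq> transpositions n \<and> length ts = k \<and> word_prod ts = v"
  then show "n - cycle_count n v \<le> k"
    using le_cycle_count_word_prod by fastforce
qed

section \<open>Pattern occurrences\<close>

text \<open>Positions given as a list can be unfolded entry by entry for a concrete pattern. List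
  index \<open>k\<close> stands for pattern position \<open>k + 1\<close>.\<close>

lemma avoids_one_line_iff:
  "avoids n w (length xs) (one_line xs) \<longleftrightarrow>
     \<not> (\<exists>ps. length ps = length xs \<and> sorted_wrt (<) ps \<and> set ps \<subseteq> {1..n} \<and>
          (\<forall>a<length xs. \<forall>b<length xs. w (ps ! a) < w (ps ! b) \<longleftrightarrow> xs ! a < xs ! b))"
  (is "_ \<longleftrightarrow> \<not> ?R")
proof -
  let ?m = "length xs"
  let ?good = "\<lambda>pos. strict_mono_on {1..?m} pos \<and> pos ` {1..?m} \<subseteq> {1..n} \<and>
    (\<forall>a\<in>{1..?m}. \<forall>b\<in>{1..?m}. w (pos a) < w (pos b) \<longleftrightarrow> one_line xs a < one_line xs b)"
  have ?R if "\<exists>pos. ?good pos"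
  proof -
    from that obtain pos where "?good pos"
      by (elim exE)
    then have pos: "strict_mono_on {1..?m} pos" "pos ` {1..?m} \<subseteq> {1..n}"
      "a \<in> {1..?m} \<Longrightarrow> b \<in> {1..?m} \<Longrightarrow>
         w (pos a) < w (pos b) \<longleftrightarrow> one_line xs a < one_line xs b" for a b
      by simp_all
    define ps where "ps = map (\<lambda>k. pos (Suc k)) [0..<?m]"
    have nth: "ps ! k = pos (Suc k)" if "k < ?m" for k
      using that by (simp add: ps_def)
    have len: "length ps = ?m"
      by (simp add: ps_def)
    have "sorted_wrt (<) ps"
      unfolding sorted_wrt_iff_nth_less len
      using pos(1) by (auto simp: nth strict_mono_on_def)
    moreover have "set ps \<subseteq> {1..n}"
      using pos(2) by (fastforce simp: ps_def)
    moreover have "w (ps ! a) < w (ps ! b) \<longleftrightarrow> xs ! a < xs ! b" if "a < ?m" "b < ?m" for a b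
      using pos(3)[of "Suc a" "Suc b"] that by (simp add: nth one_line_def)
    ultimately show ?R
      using len by (intro exI[of _ ps] conjI allI impI)
  qed
  moreover have "\<exists>pos. ?good pos" if ?R
  proof -
    from that obtain ps where "length ps = ?m \<and> sorted_wrt (<) ps \<and> set ps \<subseteq> {1..n} \<and>
        (\<forall>a<?m. \<forall>b<?m. w (ps ! a) < w (ps ! b) \<longleftrightarrow> xs ! a < xs ! b)"
      by (elim exE)
    then have ps: "length ps = ?m" "sorted_wrt (<) ps" "set ps \<subseteq> {1..n}"
      "a < ?m \<Longrightarrow> b < ?m \<Longrightarrow> w (ps ! a) < w (ps ! b) \<longleftrightarrow> xs ! a < xs ! b" for a b
      by simp_all
    define pos where "pos k = ps ! (k - 1)" for k
    have "strict_mono_on {1..?m} pos"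
      using ps(2) unfolding strict_mono_on_def pos_def
      by (auto simp: ps(1) intro!: sorted_wrt_nth_less[of "(<)"])
    moreover have "pos ` {1..?m} \<subseteq> {1..n}"
    proof (rule image_subsetI)
      fix k assume "k \<in> {1..?m}"
      then have "k - 1 < length ps"
        using ps(1) by auto
      then show "pos k \<in> {1..n}"
        unfolding pos_def using ps(3) nth_mem by blast
    qed
    moreover have "w (pos a) < w (pos b) \<longleftrightarrow> one_line xs a < one_line xs b"
      if "a \<in> {1..?m}" "b \<in> {1..?m}" for a b
      using ps(4)[of "a - 1" "b - 1"] that by (auto simp: pos_def one_line_def)
    ultimately show "\<exists>pos. ?good pos"
      by (intro exI[of _ pos] conjI ballI)
  qed
  ultimately have "(\<exists>pos. ?good pos) \<longleftrightarrow> ?R"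
    by (rule iffI)
  then show ?thesis
    unfolding avoids_def by (rule arg_cong)
qed

lemma ex_list_iff:
  "(\<exists>ps. length ps = 0 \<and> P ps) \<longleftrightarrow> P []"
  "(\<exists>ps. length ps = Suc m \<and> P ps) \<longleftrightarrow> (\<exists>p ps. length ps = m \<and> P (p # ps))"
  by (auto simp: length_Suc_conv)

text \<open>The chain lists the positions by increasing pattern value, and all pairwise comparisons
  follow from it. Nested implications let an occurrence be refuted by instantiating the
  positions.\<close>

lemma avoids_4231_iff:
  "avoids n w 4 (one_line [4,2,3,1]) \<longleftrightarrow>
     (\<forall>p1 p2 p3 p4. 1 \<le> p1 \<longrightarrow> p1 < p2 \<longrightarrow> p2 < p3 \<longrightarrow> p3 < p4 \<longrightarrow> p4 \<le> n \<longrightarrow>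
        \<not> (w p4 < w p2 \<and> w p2 < w p3 \<and> w p3 < w p1))"
proof -
  have pattern: "(\<forall>a<4. \<forall>b<4. w ([p1, p2, p3, p4] ! a) < w ([p1, p2, p3, p4] ! b) \<longleftrightarrow>
        [4,2,3,1::nat] ! a < [4,2,3,1] ! b) \<longleftrightarrow>
      w p4 < w p2 \<and> w p2 < w p3 \<and> w p3 < w p1"
    for p1 p2 p3 p4
    by (simp add: numeral_eq_Suc All_less_Suc, intro iffI conjI; elim conjE; linarith)
  have len: "length [4,2,3,1::nat] = 4"
    by simp
  have "avoids n w 4 (one_line [4,2,3,1]) \<longleftrightarrow>
      \<not> (\<exists>p1 p2 p3 p4. sorted_wrt (<) [p1, p2, p3, p4] \<and>
        set [p1, p2, p3, p4] \<subseteq> {1..n} \<and>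
        (w p4 < w p2 \<and> w p2 < w p3 \<and> w p3 < w p1))"
    unfolding avoids_one_line_iff[of n w "[4,2,3,1]", unfolded len] pattern[symmetric]
    by (simp only: ex_list_iff numeral_eq_Suc pred_numeral_simps BitM.simps One_nat_def)
  moreover have "sorted_wrt (<) [p1, p2, p3, p4] \<and> set [p1, p2, p3, p4] \<subseteq> {1..n} \<longleftrightarrow>
      1 \<le> p1 \<and> p1 < p2 \<and> p2 < p3 \<and> p3 < p4 \<and> p4 \<le> n"
    for p1 p2 p3 p4
    by auto
  ultimately show ?thesis
    by (simp only: conj_assoc[symmetric],
        simp only: conj_assoc not_ex imp_conv_disj de_Morgan_conj disj_assoc)
qed

lemma avoids_35142_iff:
  "avoids n w 5 (one_line [3,5,1,4,2]) \<longleftrightarrow>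
     (\<forall>p1 p2 p3 p4 p5. 1 \<le> p1 \<longrightarrow> p1 < p2 \<longrightarrow> p2 < p3 \<longrightarrow> p3 < p4 \<longrightarrow> p4 < p5 \<longrightarrow> p5 \<le> n \<longrightarrow>
        \<not> (w p3 < w p5 \<and> w p5 < w p1 \<and> w p1 < w p4 \<and> w p4 < w p2))"
proof -
  have pattern: "(\<forall>a<5. \<forall>b<5. w ([p1, p2, p3, p4, p5] ! a) < w ([p1, p2, p3, p4, p5] ! b) \<longleftrightarrow>
        [3,5,1,4,2::nat] ! a < [3,5,1,4,2] ! b) \<longleftrightarrow>
      w p3 < w p5 \<and> w p5 < w p1 \<and> w p1 < w p4 \<and> w p4 < w p2"
    for p1 p2 p3 p4 p5
    by (simp add: numeral_eq_Suc All_less_Suc, intro iffI conjI; elim conjE; linarith)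
  have len: "length [3,5,1,4,2::nat] = 5"
    by simp
  have "avoids n w 5 (one_line [3,5,1,4,2]) \<longleftrightarrow>
      \<not> (\<exists>p1 p2 p3 p4 p5. sorted_wrt (<) [p1, p2, p3, p4, p5] \<and>
        set [p1, p2, p3, p4, p5] \<subseteq> {1..n} \<and>
        (w p3 < w p5 \<and> w p5 < w p1 \<and> w p1 < w p4 \<and> w p4 < w p2))"
    unfolding avoids_one_line_iff[of n w "[3,5,1,4,2]", unfolded len] pattern[symmetric]
    by (simp only: ex_list_iff numeral_eq_Suc pred_numeral_simps BitM.simps One_nat_def)
  moreover have "sorted_wrt (<) [p1, p2, p3, p4, p5] \<and> set [p1, p2, p3, p4, p5] \<subseteq> {1..n} \<longleftrightarrow>
      1 \<le> p1 \<and> p1 < p2 \<and> p2 < p3 \<and> p3 < p4 \<and> p4 < p5 \<and> p5 \<le> n"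
    for p1 p2 p3 p4 p5
    by auto
  ultimately show ?thesis
    by (simp only: conj_assoc[symmetric],
        simp only: conj_assoc not_ex imp_conv_disj de_Morgan_conj disj_assoc)
qed

lemma avoids_42513_iff:
  "avoids n w 5 (one_line [4,2,5,1,3]) \<longleftrightarrow>
     (\<forall>p1 p2 p3 p4 p5. 1 \<le> p1 \<longrightarrow> p1 < p2 \<longrightarrow> p2 < p3 \<longrightarrow> p3 < p4 \<longrightarrow> p4 < p5 \<longrightarrow> p5 \<le> n \<longrightarrow>
        \<not> (w p4 < w p2 \<and> w p2 < w p5 \<and> w p5 < w p1 \<and> w p1 < w p3))"
proof -
  have pattern: "(\<forall>a<5. \<forall>b<5. w ([p1, p2, p3, p4, p5] ! a) < w ([p1, p2, p3, p4, p5] ! b) \<longleftrightarrow>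
        [4,2,5,1,3::nat] ! a < [4,2,5,1,3] ! b) \<longleftrightarrow>
      w p4 < w p2 \<and> w p2 < w p5 \<and> w p5 < w p1 \<and> w p1 < w p3"
    for p1 p2 p3 p4 p5
    by (simp add: numeral_eq_Suc All_less_Suc, intro iffI conjI; elim conjE; linarith)
  have len: "length [4,2,5,1,3::nat] = 5"
    by simp
  have "avoids n w 5 (one_line [4,2,5,1,3]) \<longleftrightarrow>
      \<not> (\<exists>p1 p2 p3 p4 p5. sorted_wrt (<) [p1, p2, p3, p4, p5] \<and>
        set [p1, p2, p3, p4, p5] \<subseteq> {1..n} \<and>
        (w p4 < w p2 \<and> w p2 < w p5 \<and> w p5 < w p1 \<and> w p1 < w p3))"
    unfolding avoids_one_line_iff[of n w "[4,2,5,1,3]", unfolded len] pattern[symmetric]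
    by (simp only: ex_list_iff numeral_eq_Suc pred_numeral_simps BitM.simps One_nat_def)
  moreover have "sorted_wrt (<) [p1, p2, p3, p4, p5] \<and> set [p1, p2, p3, p4, p5] \<subseteq> {1..n} \<longleftrightarrow>
      1 \<le> p1 \<and> p1 < p2 \<and> p2 < p3 \<and> p3 < p4 \<and> p4 < p5 \<and> p5 \<le> n"
    for p1 p2 p3 p4 p5
    by auto
  ultimately show ?thesis
    by (simp only: conj_assoc[symmetric],
        simp only: conj_assoc not_ex imp_conv_disj de_Morgan_conj disj_assoc)
qed

lemma avoids_351624_iff:
  "avoids n w 6 (one_line [3,5,1,6,2,4]) \<longleftrightarrow>
     (\<forall>p1 p2 p3 p4 p5 p6. 1 \<le> p1 \<longrightarrow> p1 < p2 \<longrightarrow> p2 < p3 \<longrightarrow> p3 < p4 \<longrightarrow> p4 < p5 \<longrightarrow> p5 < p6 \<longrightarrow> p6 \<le> n \<longrightarrow>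
        \<not> (w p3 < w p5 \<and> w p5 < w p1 \<and> w p1 < w p6 \<and> w p6 < w p2 \<and> w p2 < w p4))"
proof -
  have pattern: "(\<forall>a<6. \<forall>b<6. w ([p1, p2, p3, p4, p5, p6] ! a) < w ([p1, p2, p3, p4, p5, p6] ! b) \<longleftrightarrow>
        [3,5,1,6,2,4::nat] ! a < [3,5,1,6,2,4] ! b) \<longleftrightarrow>
      w p3 < w p5 \<and> w p5 < w p1 \<and> w p1 < w p6 \<and> w p6 < w p2 \<and> w p2 < w p4"
    for p1 p2 p3 p4 p5 p6
    by (simp add: numeral_eq_Suc All_less_Suc, intro iffI conjI; elim conjE; linarith)
  have len: "length [3,5,1,6,2,4::nat] = 6"
    by simp
  have "avoids n w 6 (one_line [3,5,1,6,2,4]) \<longleftrightarrow>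
      \<not> (\<exists>p1 p2 p3 p4 p5 p6. sorted_wrt (<) [p1, p2, p3, p4, p5, p6] \<and>
        set [p1, p2, p3, p4, p5, p6] \<subseteq> {1..n} \<and>
        (w p3 < w p5 \<and> w p5 < w p1 \<and> w p1 < w p6 \<and> w p6 < w p2 \<and> w p2 < w p4))"
    unfolding avoids_one_line_iff[of n w "[3,5,1,6,2,4]", unfolded len] pattern[symmetric]
    by (simp only: ex_list_iff numeral_eq_Suc pred_numeral_simps BitM.simps One_nat_def)
  moreover have "sorted_wrt (<) [p1, p2, p3, p4, p5, p6] \<and> set [p1, p2, p3, p4, p5, p6] \<subseteq> {1..n} \<longleftrightarrow>
      1 \<le> p1 \<and> p1 < p2 \<and> p2 < p3 \<and> p3 < p4 \<and> p4 < p5 \<and> p5 < p6 \<and> p6 \<le> n"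
    for p1 p2 p3 p4 p5 p6
    by auto
  ultimately show ?thesis
    by (simp only: conj_assoc[symmetric],
        simp only: conj_assoc not_ex imp_conv_disj de_Morgan_conj disj_assoc)
qed

section \<open>Bruhat steps acting on the cycles of \<open>inv w \<circ> u\<close>\<close>

lemma bruhat_graph_stepE:
  assumes "(u, u') \<in> bruhat_graph n" "w permutes {1..n}"
  obtains i j where "i \<in> {1..n}" "j \<in> {1..n}" "i < j" "u i < u j" "u' = u \<circ> transpose i j"
    "inv w \<circ> u permutes {1..n}" "inv w \<circ> u' = (inv w \<circ> u) \<circ> transpose i j"
proof -
  obtain i j where ij: "1 \<le> i" "i < j" "j \<le> n" "u i < u j" "u' = u \<circ> transpose i j"
    using assms(1) by (auto simp: bruhat_graph_iff)
  have "inv w \<circ> u permutes {1..n}"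
    using bruhat_graph_permutes(1)[OF assms(1)] permutes_inv[OF assms(2)]
    by (rule permutes_compose)
  with ij show thesis
    by (intro that[of i j]) (simp_all only: comp_assoc atLeastAtMost_iff, simp_all)
qed

text \<open>The path ends at \<open>inv w \<circ> w = id\<close> with \<open>n\<close> cycles, and a
  step gains at most one. Hence the absolute length never exceeds the directed distance.\<close>

lemma cycle_count_path_bound:
  assumes "(u, w) \<in> bruhat_graph n ^^ k" "w permutes {1..n}"
  shows "n \<le> k + cycle_count n (inv w \<circ> u)"
  using assms(1)
proof (induction k arbitrary: u)
  case 0
  then have "inv w \<circ> u = id"
    using permutes_inv_o(2)[OF assms(2)] by simp
  then show ?case
    by (simp only: cycle_count_id)
next
  case (Suc k)
  then obtain u' where u': "(u, u') \<in> bruhat_graph n" "(u', w) \<in> bruhat_graph n ^^ k"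
    by (meson relpow_Suc_D2)
  then obtain i j where ij: "i \<in> {1..n}" "j \<in> {1..n}" "inv w \<circ> u permutes {1..n}"
    "inv w \<circ> u' = (inv w \<circ> u) \<circ> transpose i j"
    using bruhat_graph_stepE[OF u'(1) assms(2)] by metis
  have "inv w \<circ> u' permutes {1..n}"
    unfolding ij(4) using ij(3,1,2) by (rule permutes_comp_transpose)
  moreover have "(inv w \<circ> u') \<circ> transpose i j = inv w \<circ> u"
    unfolding ij(4) by (simp add: comp_assoc)
  ultimately have "cycle_count n (inv w \<circ> u') \<le> cycle_count n (inv w \<circ> u) + 1"
    using cycle_count_comp_transpose_le[of "inv w \<circ> u'" n i j] ij(1,2) by metis
  with Suc.IH[OF u'(2)] show ?case
    by linarith
qed

section \<open>The right hull of a permutation\<close>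

text \<open>Since \<open>w\<close> fixes everything outside \<open>{1..n}\<close>, the quantifiers need no bounds.\<close>

definition in_hull :: "(nat \<Rightarrow> nat) \<Rightarrow> (nat \<Rightarrow> nat) \<Rightarrow> bool"
  where "in_hull w u \<longleftrightarrow> (\<forall>i. (\<exists>k\<le>i. u i \<le> w k) \<and> (\<exists>k\<ge>i. w k \<le> u i))"

text \<open>Backwards along an edge, the cells of \<open>u\<close> at \<open>i\<close> and
  \<open>j\<close> both inherit the upper left witness of \<open>(i, u' i)\<close> and the lower
  right witness of \<open>(j, u' j)\<close>.\<close>

lemma in_hull_of_bruhat_path:
  assumes "(u, w) \<in> (bruhat_graph n)\<^sup>*"
  shows "in_hull w u"
  using assms
proof (induction rule: converse_rtrancl_induct)
  case base
  show ?case
    by (auto simp: in_hull_def)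
next
  case (step u u')
  then obtain i j where ij: "i < j" "u i < u j" and u': "u' = u \<circ> transpose i j"
    by (auto simp: bruhat_graph_iff)
  have hull: "\<exists>k\<le>p. u' p \<le> w k" "\<exists>k\<ge>p. w k \<le> u' p" for p
    using step.IH by (auto simp: in_hull_def)
  have vals: "u' i = u j" "u' j = u i" "p \<noteq> i \<Longrightarrow> p \<noteq> j \<Longrightarrow> u' p = u p" for p
    by (simp_all add: u')
  have "(\<exists>k\<le>p. u p \<le> w k) \<and> (\<exists>k\<ge>p. w k \<le> u p)" for p
  proof -
    consider "p = i" | "p = j" | "p \<noteq> i" "p \<noteq> j"
      by blast
    then show ?thesis
    proof cases
      case 1
      then show ?thesis
        using hull(1)[of i] hull(2)[of j] ij unfolding vals by (meson less_imp_le order_trans)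
    next
      case 2
      then show ?thesis
        using hull(1)[of i] hull(2)[of j] ij unfolding vals by (meson less_imp_le order_trans)
    next
      case 3
      then show ?thesis
        using hull[of p] vals(3) by simp
    qed
  qed
  then show ?case
    by (simp add: in_hull_def)
qed

text \<open>The new cells \<open>(a, u p)\<close> and \<open>(p, u a)\<close> are the upper left and
  lower right corners of the rectangle of the exchange. The last two assumptions supply the
  witnesses beyond these corners; the opposite ones come from \<open>(a, u a)\<close> and
  \<open>(p, u p)\<close>.\<close>

lemma in_hull_comp_transpose:
  assumes "in_hull w u" "a < p" "u a < u p" "\<exists>k\<le>a. u p \<le> w k" "\<exists>k\<ge>p. w k \<le> u a"
  shows "in_hull w (u \<circ> transpose a p)"
proof -
  have "(\<exists>k\<le>i. (u \<circ> transpose a p) i \<le> w k) \<and> (\<exists>k\<ge>i. w k \<le> (u \<circ> transpose a p) i)" for i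
  proof -
    have hull: "\<exists>k\<le>i. u i \<le> w k" "\<exists>k\<ge>i. w k \<le> u i" for i
      using assms(1) by (auto simp: in_hull_def)
    consider "i = a" | "i = p" | "i \<noteq> a" "i \<noteq> p"
      by blast
    then show ?thesis
    proof cases
      case 1
      then show ?thesis
        using assms hull(2)[of a] by (metis comp_apply less_imp_le order_trans transpose_apply_first)
    next
      case 2
      then show ?thesis
        using assms hull(1)[of p] by (metis comp_apply less_imp_le order_trans transpose_apply_second)
    next
      case 3
      then show ?thesis
        using hull[of i] by simp
    qed
  qed
  then show ?thesis
    unfolding in_hull_def by blast
qed

text \<open>If \<open>w a < u a\<close>, avoidance makes \<open>w\<close> stay weakly below
  \<open>w a\<close> between \<open>a\<close> and some \<open>s\<close>, and weakly above it after
  \<open>s\<close>. The hull then leaves \<open>u\<close> too few positions for its values up to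
  \<open>w a\<close>.\<close>

lemma first_difference_less:
  assumes w: "w permutes {1..n}" and u: "u permutes {1..n}" and hull: "in_hull w u"
    and agree: "\<And>i. i < a \<Longrightarrow> u i = w i" and diff: "u a \<noteq> w a"
    and av4231: "avoids n w 4 (one_line [4,2,3,1])"
    and av42513: "avoids n w 5 (one_line [4,2,5,1,3])"
  shows "u a < w a"
proof (rule ccontr)
  assume "\<not> u a < w a"
  with diff have gt: "w a < u a"
    by simp
  note av4231 = av4231[unfolded avoids_4231_iff, rule_format]
    and av42513 = av42513[unfolded avoids_42513_iff, rule_format]
  have w_inj: "w x = w y \<longleftrightarrow> x = y" and u_inj: "u x = u y \<longleftrightarrow> x = y" for x y
    using permutes_inj[OF w] permutes_inj[OF u] by (auto simp: inj_eq)
  have a: "1 \<le> a" "a \<le> n"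
    using diff permutes_not_in[OF w, of a] permutes_not_in[OF u, of a] by fastforce+
  have w0: "w 0 = 0"
    using permutes_not_in[OF w, of 0] by simp
  have le_n: "x \<le> n" if "w x \<le> n" for x
    using that permutes_not_in[OF w, of x] by (cases "x \<in> {1..n}") auto
  have "w a \<le> n" "u a \<le> n"
    using a permutes_in_image[OF w, of a] permutes_in_image[OF u, of a] by auto
  \<comment> \<open>\<open>q\<close> will be the 4 of both patterns.\<close>
  obtain q where q: "q < a" "u a < w q" "1 \<le> q"
  proof -
    obtain k where k: "k \<le> a" "u a \<le> w k"
      using hull by (auto simp: in_hull_def)
    then have "k < a"
      using gt by (cases "k = a") auto
    moreover from this have "u a < w k"
      using k(2) agree[of k] u_inj[of a k] by (cases "u a = w k") auto
    moreover from this have "1 \<le> k"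
      using w0 by (cases k) auto
    ultimately show ?thesis
      by (rule that)
  qed
  obtain h where h: "w h = u a"
    using permutes_surj[OF w] by (metis surjD)
  have "a < h"
  proof (rule ccontr)
    assume "\<not> a < h"
    then consider "h < a" | "h = a"
      by linarith
    then show False
      using agree[of h] u_inj[of h a] h gt by cases auto
  qed
  define s where "s = (LEAST s. a < s \<and> w a < w s)"
  have s: "a < s" "w a < w s"
    using LeastI[of "\<lambda>s. a < s \<and> w a < w s" h] \<open>a < h\<close> h gt by (auto simp: s_def)
  have s_least: "w x \<le> w a" if "a < x" "x < s" for x
    using not_less_Least[of x "\<lambda>s. a < s \<and> w a < w s"] that by (auto simp: s_def not_less)
  have above: "w a \<le> w x" if "s < x" for x
  proof (rule ccontr)
    assume "\<not> w a \<le> w x"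
    then have x: "w x < w a" "x \<le> n"
      using le_n[of x] \<open>w a \<le> n\<close> by auto
    have "w s \<noteq> w q"
      using s q by (simp add: w_inj)
    then consider "w s < w q" | "w q < w s"
      by linarith
    then show False
    proof cases
      case 1
      with av4231[of q a s x] show False
        using q s that x by auto
    next
      \<comment> \<open>Now \<open>w s\<close> is too large to be the 3 of 4231. The value
        \<open>w h = u a\<close>, strictly between \<open>w a\<close> and \<open>w q\<close>, is the
        3 of 42513 or 4231, according to the order of \<open>x\<close> and \<open>h\<close>.\<close>
      case 2
      have "s \<le> h"
        unfolding s_def using \<open>a < h\<close> h gt by (intro Least_le) auto
      moreover have "s \<noteq> h" "h \<noteq> x"
        using 2 h q x gt by auto
      ultimately consider "x < h" | "s < h" "h < x"
        by linarith
      then show False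
      proof cases
        case 1
        with av42513[of q a s x h] show False
          using 2 q s that x h gt le_n[of h] \<open>u a \<le> n\<close> by auto
      next
        case 2
        with av4231[of q a h x] show False
          using q s x h gt \<open>a < h\<close> by auto
      qed
    qed
  qed
  \<comment> \<open>Positions with value at most \<open>w a\<close> are counted in \<open>u\<close>
    and in \<open>w\<close>. Both are bijections of the naturals and the value 0 is included, hence
    \<open>w a + 1\<close> each time.\<close>
  define J where "J = u -` {..w a}"
  define X where "X = w -` {..w a}"
  have card: "card J = w a + 1" "card X = w a + 1"
    unfolding J_def X_def using permutes_inj[OF u] permutes_surj[OF u] permutes_inj[OF w]
      permutes_surj[OF w] by (simp_all add: card_vimage_inj)
  then have "finite X"
    by (intro card_ge_0_finite) simp
  have "J \<subseteq> X - {a}"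
  proof
    fix j
    assume "j \<in> J"
    then have j: "u j \<le> w a"
      by (simp add: J_def)
    then have "j \<noteq> a"
      using gt by auto
    then consider "j < a" | "a < j"
      by linarith
    then show "j \<in> X - {a}"
    proof cases
      case 1
      then show ?thesis
        using agree[of j] j by (auto simp: X_def)
    next
      case 2
      \<comment> \<open>The lower right witness for \<open>j\<close> has value at most
        \<open>w a\<close>, so it lies before \<open>s\<close>, and so does
        \<open>j\<close>.\<close>
      obtain k where k: "j \<le> k" "w k \<le> u j"
        using hull by (auto simp: in_hull_def)
      have "k < s"
      proof (rule ccontr)
        assume "\<not> k < s"
        then consider "k = s" | "s < k"
          by linarith
        then show False
        proof cases
          case 1
          then show False
            using k j s by simp
        next
          case 2
          then have "w k = w a"
            using above[of k] k j by simp
          then show False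
            using 2 s by (simp add: w_inj)
        qed
      qed
      then show ?thesis
        using s_least[of j] 2 k by (simp add: X_def)
    qed
  qed
  moreover have "a \<in> X"
    by (simp add: X_def)
  ultimately have "J \<subset> X"
    by blast
  then have "card J < card X"
    using \<open>finite X\<close> by (rule psubset_card_mono[rotated])
  with card show False
    by simp
qed

text \<open>If no such \<open>p\<close> exists, follow the cycle from \<open>a\<close>. Its next
  position is at most \<open>M\<close>, the last place where \<open>w\<close> is at most
  \<open>u a\<close>, but before closing it must take a value in the strip above \<open>u a\<close>
  and up to \<open>w a\<close>, which is possible only beyond \<open>M\<close>. Crossing
  \<open>M\<close> produces one of the patterns.\<close>

lemma exists_ascent_in_cycle:
  assumes w: "w permutes {1..n}" and u: "u permutes {1..n}" and hull: "in_hull w u"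
    and agree: "\<And>i. i < a \<Longrightarrow> u i = w i" and less: "u a < w a"
    and av35142: "avoids n w 5 (one_line [3,5,1,4,2])"
    and av351624: "avoids n w 6 (one_line [3,5,1,6,2,4])"
  shows "\<exists>p \<in> orbit (inv w \<circ> u) a. a < p \<and> u a < u p \<and> (\<exists>k\<le>a. u p \<le> w k) \<and> (\<exists>k\<ge>p. w k \<le> u a)"
proof (rule ccontr)
  assume "\<not> ?thesis"
  note av35142 = av35142[unfolded avoids_35142_iff, rule_format]
    and av351624 = av351624[unfolded avoids_351624_iff, rule_format]
  from \<open>\<not> ?thesis\<close> have none: "\<not> (\<exists>k\<ge>p. w k \<le> u a)"
    if "p \<in> orbit (inv w \<circ> u) a" "a < p" "u a < u p" "k \<le> a" "u p \<le> w k" for p k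
    using that by blast
  define v where "v = inv w \<circ> u"
  define x where "x i = (v ^^ i) a" for i
  have w_inj: "w y = w z \<longleftrightarrow> y = z" and u_inj: "u y = u z \<longleftrightarrow> y = z" for y z
    using permutes_inj[OF w] permutes_inj[OF u] by (auto simp: inj_eq)
  have a: "1 \<le> a" "a \<le> n"
    using less permutes_not_in[OF w, of a] permutes_not_in[OF u, of a] by fastforce+
  have "w a \<le> n"
    using a permutes_in_image[OF w, of a] by auto
  have le_n: "y \<le> n" if "w y \<le> n" for y
    using that permutes_not_in[OF w, of y] by (cases "y \<in> {1..n}") auto
  have "v permutes {1..n}"
    unfolding v_def using u permutes_inv[OF w] by (rule permutes_compose)
  then have v: "permutation v"
    by (auto simp: permutation_permutes)
  \<comment> \<open>The next position of the cycle is where \<open>w\<close> has the value that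
    \<open>u\<close> has at the current one.\<close>
  have x_0: "x 0 = a" and w_x: "w (x (Suc i)) = u (x i)" for i
    by (simp_all add: x_def v_def permutes_inverses[OF w])
  have x_orbit: "x i \<in> orbit v a" for i
    using v by (auto simp: x_def orbit_altdef_permutation)
  have x_ge: "a \<le> x i" for i
  proof (rule ccontr)
    assume "\<not> a \<le> x i"
    then have "v (x i) = x i"
      using agree[of "x i"] by (simp add: v_def permutes_inverses[OF w])
    then have "orbit v (x i) = {x i}"
      by (simp add: orbit_eq_singleton_iff)
    then have "a = x i"
      using orbit_eq[OF v x_orbit, of i] permutation_self_in_orbit[OF v, of a] by simp
    with \<open>\<not> a \<le> x i\<close> show False
      by simp
  qed
  have x_gt: "a < x i" if "u (x i) \<noteq> u a" for i
    using x_ge[of i] that by (cases "x i = a") auto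

  have "finite (w -` {..u a})"
    using permutes_inj[OF w] by (intro finite_vimageI) auto
  moreover have "x 1 \<in> w -` {..u a}"
    using w_x[of 0] x_0 by simp
  ultimately obtain M where M: "w M \<le> u a" and M_max: "\<And>p. w p \<le> u a \<Longrightarrow> p \<le> M"
    using Max_in[of "w -` {..u a}"] Max_ge[of "w -` {..u a}"] by fastforce
  have x1: "x 1 \<le> M"
    using M_max w_x[of 0] x_0 by simp
  have beyond_M: "u a < w p" if "M < p" for p
    using M_max[of p] that by (meson leD not_less)
  \<comment> \<open>Up to \<open>M\<close> the lower right witness is available, so the upper left
    one must fail. With \<open>k = a\<close>, no value in the strip occurs there.\<close>
  have jump: "w k < u (x i)" if "x i \<le> M" "u a < u (x i)" "k \<le> a" for i k
  proof (rule ccontr)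
    assume "\<not> w k < u (x i)"
    then have "\<not> (\<exists>k\<ge>x i. w k \<le> u a)"
      using x_orbit[of i] x_gt[of i] that(2,3) unfolding v_def by (intro none[of _ k]) auto
    with that(1) M show False
      by blast
  qed

  define strip where "strip = {u a<..w a}"
  obtain N where N: "0 < N" "x N = a"
    using permutation_self_in_orbit[OF v, of a] by (auto simp: orbit_altdef x_def)
  then obtain N' where N': "N = Suc N'"
    by (cases N) auto
  \<comment> \<open>The step that closes the cycle takes the value \<open>w a\<close>, so the strip
    is reached.\<close>
  have "u (x N') = w a"
    using w_x[of N'] N N' by simp
  moreover have "N' \<noteq> 0"
    using calculation x_0 less by (cases N') auto
  ultimately have ex: "\<exists>m. 1 \<le> m \<and> u (x m) \<in> strip"
    using less by (intro exI[of _ N']) (auto simp: strip_def)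
  define m where "m = (LEAST m. 1 \<le> m \<and> u (x m) \<in> strip)"
  have m: "1 \<le> m" "u (x m) \<in> strip"
    using LeastI_ex[OF ex] by (auto simp: m_def)
  have m_least: "u (x i) \<notin> strip" if "1 \<le> i" "i < m" for i
    using not_less_Least[of i "\<lambda>m. 1 \<le> m \<and> u (x m) \<in> strip"] that by (auto simp: m_def)
  \<comment> \<open>Here the cycle first meets the strip. \<open>w p'\<close> is the value taken one
    step earlier and will turn out to lie above the strip.\<close>
  define p' where "p' = x m"
  have p': "M < p'"
    using jump[of m a] m(2) by (fastforce simp: strip_def p'_def)
  obtain m' where m': "m = Suc m'"
    using m(1) by (cases m) auto
  have "w p' = u (x m')"
    using w_x[of m'] by (simp add: p'_def m')
  moreover have "m' \<noteq> 0"
    using calculation beyond_M[OF p'] x_0 by (cases m') auto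
  ultimately have "w a < w p'"
    using m_least[of m'] beyond_M[OF p'] by (auto simp: m' strip_def)
  \<comment> \<open>\<open>K\<close> will be the 2 of the patterns, with \<open>a\<close> as the 3
    and \<open>M\<close> as the 1.\<close>
  obtain K where K: "p' \<le> K" "w K \<le> u (x m)"
    using hull by (auto simp: in_hull_def p'_def)
  have "w K \<le> w a"
    using K(2) m(2) by (auto simp: strip_def)
  then have "p' < K"
    using K(1) \<open>w a < w p'\<close> by (cases "K = p'") auto
  have "a < M"
    using x1 x_ge[of 1] w_x[of 0] x_0 less M by (cases "x 1 = a"; cases "M = a") auto
  have "w K < w a"
    using \<open>w K \<le> w a\<close> \<open>p' < K\<close> p' \<open>a < M\<close> w_inj[of K a] by (cases "w K = w a") auto
  have "u a < w K"
    using \<open>p' < K\<close> p' by (intro beyond_M) simp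

  \<comment> \<open>\<open>x i\<close> is the last position up to \<open>M\<close> visited before
    \<open>p'\<close>, so the cycle crosses \<open>M\<close> from \<open>x i\<close> to
    \<open>p''\<close>. The range starts at 1, where the minimality of \<open>m\<close>
    applies.\<close>
  define i where "i = Max {i. 1 \<le> i \<and> i < m \<and> x i \<le> M}"
  have "1 < m"
    using \<open>m' \<noteq> 0\<close> m' by simp
  then have I: "finite {i. 1 \<le> i \<and> i < m \<and> x i \<le> M}" "1 \<in> {i. 1 \<le> i \<and> i < m \<and> x i \<le> M}"
    using x1 by simp_all
  have i: "1 \<le> i" "i < m" "x i \<le> M"
    using Max_in[OF I(1)] I(2) unfolding i_def by blast+
  define p'' where "p'' = x (Suc i)"
  have p'': "M < p''"
  proof (rule ccontr)
    assume *: "\<not> M < p''"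
    then have "Suc i \<noteq> m"
      using p' by (auto simp: p'_def p''_def)
    with * i have "Suc i \<in> {i. 1 \<le> i \<and> i < m \<and> x i \<le> M}"
      by (auto simp: p''_def)
    from Max_ge[OF I(1) this] show False
      by (simp add: i_def)
  qed
  have w_p'': "w p'' = u (x i)"
    by (simp add: p''_def w_x)
  then have "w a < w p''"
    using beyond_M[OF p''] m_least[OF i(1,2)] by (auto simp: strip_def)
  \<comment> \<open>The upper left witness at \<open>x i\<close> is the 5 of the patterns;
    \<open>jump\<close> places it to the right of \<open>a\<close>.\<close>
  obtain q where q: "q \<le> x i" "w p'' \<le> w q"
    using hull w_p'' by (auto simp: in_hull_def)
  have "a < q"
    using jump[of i q] i(3) q(2) beyond_M[OF p''] w_p'' by (cases "a < q") auto
  have "w p'' < w q"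
    using q i(3) p'' w_inj[of p'' q] by (cases "w p'' = w q") auto
  have "u a < w q"
    using beyond_M[OF p''] \<open>w p'' < w q\<close> by linarith
  then have "q \<noteq> M"
    using M leD by blast
  with q(1) i(3) have "q < M"
    by linarith
  have "K \<le> n"
    using le_n[of K] \<open>w K < w a\<close> \<open>w a \<le> n\<close> by linarith
  have "p'' \<noteq> K"
    using \<open>w K < w a\<close> \<open>w a < w p''\<close> by auto
  then consider "p'' < K" | "K < p''"
    by linarith
  \<comment> \<open>In 35142 the 4 is \<open>p''\<close> or \<open>p'\<close>. In 351624
    \<open>p'\<close> is the 6 and \<open>p''\<close> the 4.\<close>
  then show False
  proof cases
    case 1
    then show False
      using av35142[of a q M p'' K] a \<open>a < q\<close> \<open>q < M\<close> p'' \<open>K \<le> n\<close> M \<open>u a < w K\<close> \<open>w K < w a\<close>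
        \<open>w a < w p''\<close> \<open>w p'' < w q\<close> by simp
  next
    case 2
    have "p'' \<le> n"
    proof (rule ccontr)
      assume "\<not> p'' \<le> n"
      then have "w p'' = p''"
        using permutes_not_in[OF w, of p''] by simp
      moreover have "q \<le> n" "1 \<le> q"
        using \<open>q < M\<close> p' \<open>p' < K\<close> \<open>K \<le> n\<close> \<open>a < q\<close> a by simp_all
      then have "w q \<le> n"
        using permutes_in_image[OF w, of q] by simp
      ultimately show False
        using \<open>w p'' < w q\<close> \<open>\<not> p'' \<le> n\<close> by simp
    qed
    have "w p' \<noteq> w q"
      using \<open>q < M\<close> p' by (simp add: w_inj)
    then consider "w p' < w q" | "w q < w p'"
      by linarith
    then show False
    proof cases
      case 1
      then show False
        using av35142[of a q M p' K] a \<open>a < q\<close> \<open>q < M\<close> p' \<open>p' < K\<close> \<open>K \<le> n\<close> M \<open>u a < w K\<close>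
          \<open>w K < w a\<close> \<open>w a < w p'\<close> by simp
    next
      case 2
      then show False
        using av351624[of a q M p' K p''] a \<open>a < q\<close> \<open>q < M\<close> p' \<open>p' < K\<close> \<open>K < p''\<close> \<open>p'' \<le> n\<close> M
          \<open>u a < w K\<close> \<open>w K < w a\<close> \<open>w a < w p''\<close> \<open>w p'' < w q\<close> by simp
    qed
  qed
qed

section \<open>Paths of minimal length\<close>

text \<open>Each greedy exchange splits a cycle and preserves the hull condition, so induction on
  \<open>n\<close> minus the cycle count applies. The additive bound avoids truncated
  subtraction.\<close>

lemma ascending_path_of_hull:
  assumes w: "w permutes {1..n}" and u: "u permutes {1..n}" and hull: "in_hull w u"
    and av4231: "avoids n w 4 (one_line [4,2,3,1])"
    and av35142: "avoids n w 5 (one_line [3,5,1,4,2])"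
    and av42513: "avoids n w 5 (one_line [4,2,5,1,3])"
    and av351624: "avoids n w 6 (one_line [3,5,1,6,2,4])"
  shows "\<exists>k. k + cycle_count n (inv w \<circ> u) \<le> n \<and> (u, w) \<in> bruhat_graph n ^^ k"
  using u hull
proof (induction "n - cycle_count n (inv w \<circ> u)" arbitrary: u rule: less_induct)
  case less
  show ?case
  proof (cases "u = w")
    case True
    then show ?thesis
      by (intro exI[of _ 0]) (simp add: cycle_count_le)
  next
    case False
    define a where "a = (LEAST a. u a \<noteq> w a)"
    have diff: "u a \<noteq> w a"
      unfolding a_def by (rule LeastI_ex) (use False in blast)
    have agree: "u i = w i" if "i < a" for i
      using not_less_Least that unfolding a_def by blast
    have "u a < w a"
      by (rule first_difference_less[OF w less.prems agree diff av4231 av42513])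
    then obtain p where p: "p \<in> orbit (inv w \<circ> u) a" "a < p" "u a < u p"
      "\<exists>k\<le>a. u p \<le> w k" "\<exists>k\<ge>p. w k \<le> u a"
      using exists_ascent_in_cycle[OF w less.prems agree _ av35142 av351624] by blast
    have perm: "inv w \<circ> u permutes {1..n}"
      using less.prems(1) permutes_inv[OF w] by (rule permutes_compose)
    have "a \<in> {1..n}"
      using diff permutes_not_in[OF w, of a] permutes_not_in[OF less.prems(1), of a] by metis
    with p(1) have mem: "a \<in> {1..n}" "p \<in> {1..n}"
      using permutes_orbit_subset[OF perm] by blast+
    define u' where "u' = u \<circ> transpose a p"
    have comp: "inv w \<circ> u' = (inv w \<circ> u) \<circ> transpose a p"
      by (simp only: u'_def comp_assoc)
    have count: "cycle_count n (inv w \<circ> u') = cycle_count n (inv w \<circ> u) + 1"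
      unfolding comp using cycle_count_comp_transpose_split[OF perm mem] p by blast
    have "u' permutes {1..n}"
      unfolding u'_def by (rule permutes_comp_transpose[OF less.prems(1) mem])
    moreover have "in_hull w u'"
      unfolding u'_def using less.prems(2) p(2-) by (rule in_hull_comp_transpose)
    moreover have "n - cycle_count n (inv w \<circ> u') < n - cycle_count n (inv w \<circ> u)"
      using count cycle_count_le[of n "inv w \<circ> u'"] by linarith
    ultimately obtain k where k: "k + cycle_count n (inv w \<circ> u') \<le> n"
      "(u', w) \<in> bruhat_graph n ^^ k"
      using less.hyps by blast
    have "(u, u') \<in> bruhat_graph n"
      unfolding bruhat_graph_iff u'_def using less.prems(1) mem p by auto
    with k(2) have "(u, w) \<in> bruhat_graph n ^^ Suc k"
      by (intro relpow_Suc_I2)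
    with k(1) count show ?thesis
      by (intro exI[of _ "Suc k"]) linarith
  qed
qed

lemma bruhat_dist_le_iff:
  assumes "(u, w) \<in> (bruhat_graph n)\<^sup>*"
  shows "bruhat_dist n u w \<le> m \<longleftrightarrow> (\<exists>k\<le>m. (u, w) \<in> bruhat_graph n ^^ k)"
proof
  obtain k where "(u, w) \<in> bruhat_graph n ^^ k"
    using assms by (auto simp: rtrancl_power)
  then have "(u, w) \<in> bruhat_graph n ^^ bruhat_dist n u w"
    unfolding bruhat_dist_def by (rule LeastI)
  then show "\<exists>k\<le>m. (u, w) \<in> bruhat_graph n ^^ k" if "bruhat_dist n u w \<le> m"
    using that by blast
next
  assume "\<exists>k\<le>m. (u, w) \<in> bruhat_graph n ^^ k"
  then obtain k where "k \<le> m" "(u, w) \<in> bruhat_graph n ^^ k"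
    by blast
  moreover from this(2) have "bruhat_dist n u w \<le> k"
    unfolding bruhat_dist_def by (rule Least_le)
  ultimately show "bruhat_dist n u w \<le> m"
    by simp
qed

text \<open>One inequality always holds, so equality only asks for a sufficiently short path. As
  products read from the left, \<open>u \<cdot> inv w\<close> is
  \<open>inv w \<circ> u\<close>.\<close>

lemma absolute_length_eq_bruhat_dist_iff:
  assumes "bruhat_le n u w"
  shows "absolute_length n (u \<cdot> inv w) = bruhat_dist n u w \<longleftrightarrow>
    (\<exists>k. k + cycle_count n (inv w \<circ> u) \<le> n \<and> (u, w) \<in> bruhat_graph n ^^ k)"
proof -
  let ?c = "cycle_count n (inv w \<circ> u)"
  from assms have u: "u permutes {1..n}" and w: "w permutes {1..n}"
    and path: "(u, w) \<in> (bruhat_graph n)\<^sup>*"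
    by (auto simp: bruhat_le_def)
  have "inv w \<circ> u permutes {1..n}"
    using u permutes_inv[OF w] by (rule permutes_compose)
  then have abs: "absolute_length n (u \<cdot> inv w) = n - ?c"
    unfolding pmult_def by (rule absolute_length_eq)
  obtain k where "k \<le> bruhat_dist n u w" "(u, w) \<in> bruhat_graph n ^^ k"
    using bruhat_dist_le_iff[OF path] by blast
  with cycle_count_path_bound[OF _ w] have "n \<le> bruhat_dist n u w + ?c"
    by fastforce
  then have "n - ?c = bruhat_dist n u w \<longleftrightarrow> bruhat_dist n u w \<le> n - ?c"
    by linarith
  also have "\<dots> \<longleftrightarrow> (\<exists>k. k + ?c \<le> n \<and> (u, w) \<in> bruhat_graph n ^^ k)"
    unfolding bruhat_dist_le_iff[OF path]
    using cycle_count_le[of n "inv w \<circ> u"] by (simp add: le_diff_conv2)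
  finally show ?thesis
    unfolding abs .
qed

text \<open>A path as short as the absolute length only transposes positions within a cycle. Inside a
  union \<open>C\<close> of cycles its steps move larger values to the left, so the condition
  \<open>\<exists>i\<in>C. i \<le> p \<and> r \<le> x i\<close> persists along the path.\<close>

lemma minimal_path_invariant:
  assumes "(u, w) \<in> bruhat_graph n ^^ k" "w permutes {1..n}" "k + cycle_count n (inv w \<circ> u) \<le> n"
    and "\<And>i. i \<in> C \<Longrightarrow> (inv w \<circ> u) i \<in> C" and "\<exists>i\<in>C. i \<le> p \<and> r \<le> u i"
  shows "\<exists>i\<in>C. i \<le> p \<and> r \<le> w i"
  using assms(1,3-)
proof (induction k arbitrary: u)
  case 0
  then show ?case
    by simp
next
  case (Suc k)
  let ?v = "inv w \<circ> u"
  obtain u' where u': "(u, u') \<in> bruhat_graph n" "(u', w) \<in> bruhat_graph n ^^ k"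
    using Suc.prems(1) by (meson relpow_Suc_D2)
  obtain i j where ij: "i \<in> {1..n}" "j \<in> {1..n}" "i < j" "u i < u j" "u' = u \<circ> transpose i j"
    "?v permutes {1..n}" "inv w \<circ> u' = ?v \<circ> transpose i j"
    using bruhat_graph_stepE[OF u'(1) assms(2)] by metis
  have v: "permutation ?v"
    using ij(6) by (auto simp only: permutation_permutes)
  have closed: "y \<in> C" if "z \<in> C" "y \<in> orbit ?v z" for y z
    using that(2,1) by induction (simp_all only: Suc.prems(3))
  \<comment> \<open>The remaining \<open>k\<close> steps gain at most \<open>k\<close> cycles, so
    this step must already gain one; it cannot join two cycles.\<close>
  have "cycle_count n ?v < cycle_count n (?v \<circ> transpose i j)"
    using cycle_count_path_bound[OF u'(2) assms(2)] Suc.prems(2) unfolding ij(7) by linarith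
  then have j_orbit: "j \<in> orbit ?v i"
    using cycle_count_comp_transpose_merge[OF ij(6,1,2)] by (meson leD)
  then have "i \<in> orbit ?v j"
    using orbit_eq[OF v j_orbit] permutation_self_in_orbit[OF v, of i] by simp
  then have C_iff: "i \<in> C \<longleftrightarrow> j \<in> C"
    using closed[OF _ j_orbit] closed[of j i] by (intro iffI) simp_all
  have "(inv w \<circ> u') y \<in> C" if "y \<in> C" for y
  proof -
    have "transpose i j y \<in> C"
      using that C_iff
      by (metis transpose_apply_first transpose_apply_second transpose_apply_other)
    from Suc.prems(3)[OF this] show ?thesis
      unfolding ij(7) by (simp only: comp_apply)
  qed
  moreover have "\<exists>y\<in>C. y \<le> p \<and> r \<le> u' y"
  proof -
    obtain y where y: "y \<in> C" "y \<le> p" "r \<le> u y"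
      using Suc.prems(4) by blast
    consider "y = i" | "y = j" | "y \<noteq> i" "y \<noteq> j"
      by blast
    then show ?thesis
    proof cases
      case 1
      then show ?thesis
        using y ij(4) by (intro bexI[of _ i]) (simp_all add: ij(5))
    next
      \<comment> \<open>The value at \<open>j\<close> moves left to \<open>i\<close>, which lies in
        \<open>C\<close> as well.\<close>
      case 2
      then show ?thesis
        using y ij(3) C_iff by (intro bexI[of _ i]) (simp_all add: ij(5))
    next
      case 3
      then show ?thesis
        using y by (intro bexI[of _ y]) (simp_all add: ij(5))
    qed
  qed
  moreover have "k + cycle_count n (inv w \<circ> u') \<le> n"
    using cycle_count_comp_transpose_split[OF ij(6,1,2) _ j_orbit] ij(3) Suc.prems(2)
    unfolding ij(7) by linarith
  ultimately show ?case
    using u'(2) Suc.IH by blast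
qed

text \<open>Taking \<open>u = w \<circ> v\<close> gives \<open>inv w \<circ> u = v\<close>, so its
  cycles can be prescribed. The last two assumptions make the invariant hold for \<open>u\<close>
  and fail for \<open>w\<close>.\<close>

lemma absolute_length_neq_bruhat_dist:
  assumes "w permutes {1..n}" "v permutes {1..n}" "(w \<circ> v, w) \<in> (bruhat_graph n)\<^sup>*"
    and "v ` C \<subseteq> C" and "\<exists>i\<in>C. i \<le> p \<and> r \<le> w (v i)" and "\<And>i. i \<in> C \<Longrightarrow> i \<le> p \<Longrightarrow> w i < r"
  shows "\<exists>u. bruhat_less n u w \<and> absolute_length n (u \<cdot> inv w) \<noteq> bruhat_dist n u w"
proof (intro exI conjI notI)
  let ?u = "w \<circ> v"
  have inv: "inv w \<circ> ?u = v"
    by (simp only: comp_assoc[symmetric] permutes_inv_o(2)[OF assms(1)] id_comp)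
  have "?u permutes {1..n}"
    using assms(2,1) by (rule permutes_compose)
  with assms(1,3) have le: "bruhat_le n ?u w"
    by (simp only: bruhat_le_def simp_thms)
  have final: "\<not> (\<exists>i\<in>C. i \<le> p \<and> r \<le> w i)"
    using assms(6) by (meson not_le)
  then have "?u \<noteq> w"
    using assms(5) by (metis comp_apply)
  with le show "bruhat_less n ?u w"
    by (simp only: bruhat_less_def simp_thms)
  assume "absolute_length n (?u \<cdot> inv w) = bruhat_dist n ?u w"
  then obtain k where k: "k + cycle_count n v \<le> n" "(?u, w) \<in> bruhat_graph n ^^ k"
    unfolding absolute_length_eq_bruhat_dist_iff[OF le] inv by blast
  have "\<exists>i\<in>C. i \<le> p \<and> r \<le> w i"
  proof (rule minimal_path_invariant[OF k(2) assms(1)])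
    show "k + cycle_count n (inv w \<circ> ?u) \<le> n"
      unfolding inv by (rule k(1))
    show "(inv w \<circ> ?u) i \<in> C" if "i \<in> C" for i
      unfolding inv using assms(4) that by blast
    show "\<exists>i\<in>C. i \<le> p \<and> r \<le> ?u i"
      using assms(5) by (simp only: comp_apply)
  qed
  with final show False ..
qed

section \<open>Short cycles from forbidden patterns\<close>

text \<open>With this order of composition, \<open>x \<circ> swaps ts\<close> exchanges values of
  \<open>x\<close> in the order of the list.\<close>

fun swaps :: "(nat \<times> nat) list \<Rightarrow> nat \<Rightarrow> nat"
  where "swaps [] = id" | "swaps ((i, j) # ts) = transpose i j \<circ> swaps ts"

fun descending :: "nat \<Rightarrow> (nat \<Rightarrow> nat) \<Rightarrow> (nat \<times> nat) list \<Rightarrow> bool"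
  where "descending n x [] \<longleftrightarrow> True"
  | "descending n x ((i, j) # ts) \<longleftrightarrow>
       1 \<le> i \<and> i < j \<and> j \<le> n \<and> x j < x i \<and> descending n (x \<circ> transpose i j) ts"

text \<open>Every listed exchange removes a descent, so undoing them from last to first ascends to
  \<open>x\<close>.\<close>

lemma bruhat_path_of_descending:
  assumes "x permutes {1..n}" "descending n x ts"
  shows "swaps ts permutes {1..n} \<and> (x \<circ> swaps ts, x) \<in> (bruhat_graph n)\<^sup>*"
  using assms
proof (induction ts arbitrary: x)
  case Nil
  show ?case
    unfolding swaps.simps comp_id by (intro conjI permutes_id rtrancl_refl)
next
  case (Cons t ts)
  obtain i j where t: "t = (i, j)"
    by fastforce
  let ?y = "x \<circ> transpose i j"
  have ij: "i \<in> {1..n}" "j \<in> {1..n}" "i < j" "x j < x i" "descending n ?y ts"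
    using Cons.prems(2) unfolding t descending.simps by simp_all
  have y: "?y permutes {1..n}"
    by (rule permutes_comp_transpose[OF Cons.prems(1) ij(1,2)])
  have eq: "?y \<circ> transpose i j = x"
    by (simp add: comp_assoc)
  have "?y i < ?y j"
    using ij(4) by simp
  then have "(?y, ?y \<circ> transpose i j) \<in> bruhat_graph n"
    unfolding bruhat_graph_iff using y ij(1-3) by (metis atLeastAtMost_iff)
  then have "(?y, x) \<in> bruhat_graph n"
    unfolding eq .
  moreover note Cons.IH[OF y ij(5)]
  ultimately have "swaps ts permutes {1..n}" "(?y \<circ> swaps ts, x) \<in> (bruhat_graph n)\<^sup>*"
    by (blast intro: rtrancl_into_rtrancl)+
  then show ?case
    unfolding t swaps.simps comp_assoc using permutes_swap_id[OF ij(1,2)]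
    by (blast intro: permutes_compose)
qed

lemma absolute_length_neq_bruhat_dist_swaps:
  assumes "w permutes {1..n}" "descending n w ts"
    and "swaps ts ` C \<subseteq> C" and "c \<in> C" "c \<le> p" "r \<le> w (swaps ts c)"
    and "\<And>i. i \<in> C \<Longrightarrow> i \<le> p \<Longrightarrow> w i < r"
  shows "\<exists>u. bruhat_less n u w \<and> absolute_length n (u \<cdot> inv w) \<noteq> bruhat_dist n u w"
  using bruhat_path_of_descending[OF assms(1,2)] assms(3-7)
  by (intro absolute_length_neq_bruhat_dist[OF assms(1), of "swaps ts" C p r]) blast+

lemma
  assumes w: "w permutes {1..n}"
  shows pattern_4231_obstruction: "\<not> avoids n w 4 (one_line [4,2,3,1]) \<Longrightarrow>
      \<exists>u. bruhat_less n u w \<and> absolute_length n (u \<cdot> inv w) \<noteq> bruhat_dist n u w"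
    and pattern_35142_obstruction: "\<not> avoids n w 5 (one_line [3,5,1,4,2]) \<Longrightarrow>
      \<exists>u. bruhat_less n u w \<and> absolute_length n (u \<cdot> inv w) \<noteq> bruhat_dist n u w"
    and pattern_42513_obstruction: "\<not> avoids n w 5 (one_line [4,2,5,1,3]) \<Longrightarrow>
      \<exists>u. bruhat_less n u w \<and> absolute_length n (u \<cdot> inv w) \<noteq> bruhat_dist n u w"
    and pattern_351624_obstruction: "\<not> avoids n w 6 (one_line [3,5,1,6,2,4]) \<Longrightarrow>
      \<exists>u. bruhat_less n u w \<and> absolute_length n (u \<cdot> inv w) \<noteq> bruhat_dist n u w"
proof -
  show "\<exists>u. bruhat_less n u w \<and> absolute_length n (u \<cdot> inv w) \<noteq> bruhat_dist n u w"
    if av: "\<not> avoids n w 4 (one_line [4,2,3,1])"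
  proof -
    obtain p1 p2 p3 p4 where "1 \<le> p1" "p1 < p2" "p2 < p3" "p3 < p4" "p4 \<le> n"
      "w p4 < w p2" "w p2 < w p3" "w p3 < w p1"
      using av unfolding avoids_4231_iff by blast
    \<comment> \<open>The result is 1324. On the cycle of \<open>p2\<close> and \<open>p3\<close>,
      \<open>w\<close> reads 2, 3 and \<open>u\<close> reads 3, 2, so the 3 comes too early in
      \<open>u\<close>.\<close>
    then show ?thesis
      by (intro absolute_length_neq_bruhat_dist_swaps[OF w,
            of "[(p1, p2), (p1, p4), (p2, p3), (p3, p4)]" "{p2, p3}" p2 p2 "w p3"]) auto
  qed
  show "\<exists>u. bruhat_less n u w \<and> absolute_length n (u \<cdot> inv w) \<noteq> bruhat_dist n u w"
    if av: "\<not> avoids n w 5 (one_line [3,5,1,4,2])"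
  proof -
    obtain p1 p2 p3 p4 p5 where "1 \<le> p1" "p1 < p2" "p2 < p3" "p3 < p4" "p4 < p5" "p5 \<le> n"
      "w p3 < w p5" "w p5 < w p1" "w p1 < w p4" "w p4 < w p2"
      using av unfolding avoids_35142_iff by blast
    \<comment> \<open>The result is 12435. On the cycle \<open>{p1, p3, p4}\<close>,
      \<open>w\<close> reads 3, 1, 4 and \<open>u\<close> reads 1, 4, 3; up to \<open>p3\<close>
      only \<open>u\<close> reaches 4.\<close>
    then show ?thesis
      by (intro absolute_length_neq_bruhat_dist_swaps[OF w,
            of "[(p1, p3), (p2, p3), (p2, p5), (p3, p4), (p4, p5)]" "{p1, p3, p4}" p3 p3 "w p4"])
        auto
  qed
  show "\<exists>u. bruhat_less n u w \<and> absolute_length n (u \<cdot> inv w) \<noteq> bruhat_dist n u w"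
    if av: "\<not> avoids n w 5 (one_line [4,2,5,1,3])"
  proof -
    obtain p1 p2 p3 p4 p5 where "1 \<le> p1" "p1 < p2" "p2 < p3" "p3 < p4" "p4 < p5" "p5 \<le> n"
      "w p4 < w p2" "w p2 < w p5" "w p5 < w p1" "w p1 < w p3"
      using av unfolding avoids_42513_iff by blast
    \<comment> \<open>The result is 13245. On the cycle \<open>{p2, p3, p5}\<close>,
      \<open>w\<close> reads 2, 5, 3 and \<open>u\<close> reads 3, 2, 5; at \<open>p2\<close> only
      \<open>u\<close> reaches 3.\<close>
    then show ?thesis
      by (intro absolute_length_neq_bruhat_dist_swaps[OF w,
            of "[(p1, p2), (p1, p4), (p2, p5), (p3, p4), (p4, p5)]" "{p2, p3, p5}" p2 p2 "w p5"])
        auto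
  qed
  show "\<exists>u. bruhat_less n u w \<and> absolute_length n (u \<cdot> inv w) \<noteq> bruhat_dist n u w"
    if av: "\<not> avoids n w 6 (one_line [3,5,1,6,2,4])"
  proof -
    obtain p1 p2 p3 p4 p5 p6 where "1 \<le> p1" "p1 < p2" "p2 < p3" "p3 < p4" "p4 < p5" "p5 < p6"
      "p6 \<le> n" "w p3 < w p5" "w p5 < w p1" "w p1 < w p6" "w p6 < w p2" "w p2 < w p4"
      using av unfolding avoids_351624_iff by blast
    \<comment> \<open>The result is 124356. On the cycle \<open>{p1, p3, p4, p6}\<close>,
      \<open>w\<close> reads 3, 1, 6, 4 and \<open>u\<close> reads 1, 4, 3, 6; up to
      \<open>p3\<close> only \<open>u\<close> reaches 4.\<close>
    then show ?thesis
      by (intro absolute_length_neq_bruhat_dist_swaps[OF w,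
            of "[(p1, p3), (p2, p3), (p2, p5), (p3, p6), (p4, p5), (p5, p6)]" "{p1, p3, p4, p6}"
              p3 p3 "w p6"]) auto
  qed
qed

theorem theorem6p3:
  fixes n :: nat and w :: "nat \<Rightarrow> nat"
  assumes "w permutes {1..n}"
  shows "(avoids n w 4 (one_line [4,2,3,1]) \<and>
          avoids n w 5 (one_line [3,5,1,4,2]) \<and>
          avoids n w 5 (one_line [4,2,5,1,3]) \<and>
          avoids n w 6 (one_line [3,5,1,6,2,4]))
     \<longleftrightarrow> (\<forall>u. bruhat_less n u w \<longrightarrow> absolute_length n (u \<cdot> inv w) = bruhat_dist n u w)"
    (is "?avoids \<longleftrightarrow> ?equal")
proof (intro iffI allI impI)
  fix u
  assume ?avoids "bruhat_less n u w"
  then have le: "bruhat_le n u w" and u: "u permutes {1..n}"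
    and path: "(u, w) \<in> (bruhat_graph n)\<^sup>*"
    by (simp_all only: bruhat_less_def bruhat_le_def)
  show "absolute_length n (u \<cdot> inv w) = bruhat_dist n u w"
    unfolding absolute_length_eq_bruhat_dist_iff[OF le]
    using \<open>?avoids\<close> by (intro ascending_path_of_hull[OF assms u in_hull_of_bruhat_path[OF path]]) auto
next
  assume ?equal
  then show ?avoids
    using pattern_4231_obstruction[OF assms] pattern_35142_obstruction[OF assms]
      pattern_42513_obstruction[OF assms] pattern_351624_obstruction[OF assms] by (intro conjI) blast+
qed

end
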